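(* Let $\mathscr{D}$ be a dyadic grid in $\mathbb{R}^d$, let $w$ be a weight with $w^{-1}\in A_1$, let $\eta\in(0,1)$, and let $\mathcal{S}\subseteq\mathscr{D}$ be an $\eta$-sparse collection of cubes with $\sum_{Q\in\mathcal S}|Q|<\infty$. Then for all $f\in L^\infty_w(\mathbb{R}^d)$, $$\|\mathcal{A}_{\mathcal S}f\|_{\mathrm{BMO}^1_w(\mathscr{D})}\lesssim\eta^{-1}[w^{-1}]_{A_\infty(\mathscr{D})}\|f\|_{L^\infty_w(\mathbb{R}^d)},$$ $$\|\mathcal{A}_{\mathcal S}f\|_{\mathrm{BMO}^\infty_w(\mathscr{D})}\lesssim\eta^{-1}[w^{-1}]_{A_1(\mathscr{D})}[w^{-1}]_{A_\infty(\mathscr{D})}\|f\|_{L^\infty_w(\mathbb{R}^d)},$$ and $$\|\mathcal{A}_{\mathcal S}f\|_{\mathrm{BMO}^{1,\mathrm{weak}}_w(\mathscr{D})}\lesssim\eta^{-1}\|f\|_{L^\infty_w(\mathbb{R}^d)},$$ $$\|\mathcal{A}_{\mathcal S}f\|_{\mathrm{BMO}^{\infty,\mathrm{weak}}_w(\mathscr{D})}\lesssim\eta^{-1}[w^{-1}]_{A_1(\mathscr{D})}\|f\|_{L^\infty_w(\mathbb{R}^d)}.$$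
   Context: $A\lesssim B$ means $A\le CB$ with $C$ an absolute constant. A cube is a half-open cube with sides parallel to the coordinate axes. A dyadic grid $\mathscr D$ is a collection of cubes such that $P\cap Q\ne\emptyset$ implies $P\subseteq Q$ or $Q\subseteq P$ for $P,Q\in\mathscr D$; $\mathscr D(Q)$ is the collection of cubes in $\mathscr D$ contained in $Q$. A weight is a measurable function $w$ with $0<w<\infty$ a.e.; $w(E)=\int_Ew\,\mathrm{d}x$. For a cube $Q$: $\langle g\rangle_Q=\frac1{|Q|}\int_Qg\,\mathrm{d}x$, $\langle g\rangle_{1,Q}=\frac1{|Q|}\int_Q|g|\,\mathrm{d}x$, $\langle g\rangle_{\infty,Q}=\operatorname{ess\,sup}_Q|g|$, $\|g\|_{L^{1,\infty}(Q)}=\sup_{t>0}t\,|\{x\in Q:|g(x)|>t\}|$. A collection $\mathcal S$ of sets is $\eta$-sparse if there are pairwise disjoint sets $\{E_S\}_{S\in\mathcal S}$ with $E_S\subseteq S$ and $|E_S|\ge\eta|S|$ for all $S\in\mathcal S$. The associated sparse operator is $\mathcal A_{\mathcal S}f=\sum_{Q\in\mathcal S}\langle f\rangle_{1,Q}\mathbf 1_Q$. $v\in A_1$ means $\sup_Q\langle v\rangle_{1,Q}\langle v^{-1}\rangle_{\infty,Q}<\infty$, supremum over all cubes in $\mathbb{R}^d$. Put $[v]_{A_1(\mathscr D)}=\sup_{Q\in\mathscr D}\langle v\rangle_{1,Q}\langle v^{-1}\rangle_{\infty,Q}$ and $[v]_{A_\infty(\mathscr D)}=\sup_{Q\in\mathscr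 D}\frac1{v(Q)}\int_QM^{\mathscr D(Q)}v\,\mathrm{d}x$, where $M^{\mathscr E}g=\sup_{P\in\mathscr E}\langle g\rangle_{1,P}\mathbf 1_P$. $\|f\|_{L^\infty_w(\mathbb{R}^d)}=\|fw\|_{L^\infty(\mathbb{R}^d)}$. The weighted dyadic BMO norms (functions identified modulo constants on cubes in $\mathscr D$) are $$\|f\|_{\mathrm{BMO}^1_w(\mathscr D)}=\sup_{Q\in\mathscr D}\frac{\langle f-\langle f\rangle_Q\rangle_{1,Q}}{\langle w^{-1}\rangle_{1,Q}},\qquad\|f\|_{\mathrm{BMO}^\infty_w(\mathscr D)}=\sup_{Q\in\mathscr D}\langle w\rangle_{\infty,Q}\langle f-\langle f\rangle_Q\rangle_{1,Q},$$ $$\|f\|_{\mathrm{BMO}^{1,\mathrm{weak}}_w(\mathscr D)}=\sup_{Q\in\mathscr D}\inf_{c\in\mathbb{R}}\frac{\|(f-c)\mathbf 1_Q\|_{L^{1,\infty}(Q)}}{w^{-1}(Q)},\qquad\|f\|_{\mathrm{BMO}^{\infty,\mathrm{weak}}_w(\mathscr D)}=\sup_{Q\in\mathscr D}\inf_{c\in\mathbb{R}}\langle w\rangle_{\infty,Q}|Q|^{-1}\|(f-c)\mathbf 1_Q\|_{L^{1,\infty}(Q)}.$$ *)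

theory Defs
  imports "HOL-Analysis.Analysis" "HOL-Probability.Essential_Supremum"
begin

text \<open>
  The constants in \<open>\<lesssim>\<close> are absolute, hence independent of the dimension \<open>d\<close>, so the dimension
  has to be quantified inside the statement. A point of \<open>\<real>\<^sup>d\<close> is therefore represented by a function
  \<open>nat \<Rightarrow> real\<close> on \<open>{..<d}\<close>, extended by \<open>undefined\<close>, as usual for \<open>PiM\<close>; the completion turns
  the product Borel-Lebesgue measure into Lebesgue measure.
\<close>

definition leb :: "nat \<Rightarrow> (nat \<Rightarrow> real) measure" where
  "leb d = completion (PiM {..<d} (\<lambda>_. lborel))"

definition cubes :: "nat \<Rightarrow> (nat \<Rightarrow> real) set set" where
  "cubes d = {PiE {..<d} (\<lambda>i. {a i..<a i + l}) | a l. 0 < l}"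

definition dyadic_grid :: "nat \<Rightarrow> (nat \<Rightarrow> real) set set \<Rightarrow> bool" where
  "dyadic_grid d D \<longleftrightarrow> D \<subseteq> cubes d \<and> (\<forall>P\<in>D. \<forall>Q\<in>D. P \<inter> Q \<noteq> {} \<longrightarrow> P \<subseteq> Q \<or> Q \<subseteq> P)"

definition subcubes :: "(nat \<Rightarrow> real) set set \<Rightarrow> (nat \<Rightarrow> real) set \<Rightarrow> (nat \<Rightarrow> real) set set" where
  "subcubes D Q = {P \<in> D. P \<subseteq> Q}"

text \<open>
  Weights are real-valued, so \<open>w < \<infinity>\<close> is automatic. The reciprocal of \<open>w\<close> is \<open>\<lambda>x. inverse (w x)\<close>;
  the convention \<open>inverse 0 = 0\<close> only matters on a null set.
\<close>

definition weight :: "nat \<Rightarrow> ((nat \<Rightarrow> real) \<Rightarrow> real) \<Rightarrow> bool" where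
  "weight d w \<longleftrightarrow> w \<in> borel_measurable (leb d) \<and> (AE x in leb d. 0 < w x)"

definition wmeasure :: "nat \<Rightarrow> ((nat \<Rightarrow> real) \<Rightarrow> real) \<Rightarrow> (nat \<Rightarrow> real) set \<Rightarrow> ennreal" where
  "wmeasure d w E = (\<integral>\<^sup>+x\<in>E. ennreal (w x) \<partial>leb d)"

definition avg :: "nat \<Rightarrow> (nat \<Rightarrow> real) set \<Rightarrow> ((nat \<Rightarrow> real) \<Rightarrow> real) \<Rightarrow> real" where
  "avg d Q g = (LINT x:Q|leb d. g x) / measure (leb d) Q"

definition avg1 :: "nat \<Rightarrow> (nat \<Rightarrow> real) set \<Rightarrow> ((nat \<Rightarrow> real) \<Rightarrow> real) \<Rightarrow> ennreal" where
  "avg1 d Q g = (\<integral>\<^sup>+x\<in>Q. ennreal \<bar>g x\<bar> \<partial>leb d) / emeasure (leb d) Q"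

definition avg_inf :: "nat \<Rightarrow> (nat \<Rightarrow> real) set \<Rightarrow> ((nat \<Rightarrow> real) \<Rightarrow> real) \<Rightarrow> ennreal" where
  "avg_inf d Q g = esssup (restrict_space (leb d) Q) (\<lambda>x. ennreal \<bar>g x\<bar>)"

definition weak_L1_norm :: "nat \<Rightarrow> (nat \<Rightarrow> real) set \<Rightarrow> ((nat \<Rightarrow> real) \<Rightarrow> real) \<Rightarrow> ennreal" where
  "weak_L1_norm d Q g = (SUP t\<in>{0<..}. ennreal t * emeasure (leb d) {x \<in> Q. t < \<bar>g x\<bar>})"

definition sparse_collection :: "nat \<Rightarrow> real \<Rightarrow> (nat \<Rightarrow> real) set set \<Rightarrow> bool" where
  "sparse_collection d \<eta> \<S> \<longleftrightarrow> (\<exists>E. disjoint_family_on E \<S> \<and>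
     (\<forall>S\<in>\<S>. E S \<in> sets (leb d) \<and> E S \<subseteq> S \<and> ennreal \<eta> * emeasure (leb d) S \<le> emeasure (leb d) (E S)))"

definition sparse_op ::
  "nat \<Rightarrow> (nat \<Rightarrow> real) set set \<Rightarrow> ((nat \<Rightarrow> real) \<Rightarrow> real) \<Rightarrow> (nat \<Rightarrow> real) \<Rightarrow> ennreal" where
  "sparse_op d \<S> f x = (\<Sum>\<^sub>\<infinity>Q\<in>\<S>. avg1 d Q f * indicator Q x)"

definition A1_const :: "nat \<Rightarrow> (nat \<Rightarrow> real) set set \<Rightarrow> ((nat \<Rightarrow> real) \<Rightarrow> real) \<Rightarrow> ennreal" where
  "A1_const d D v = (SUP Q\<in>D. avg1 d Q v * avg_inf d Q (\<lambda>x. inverse (v x)))"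

definition A1 :: "nat \<Rightarrow> ((nat \<Rightarrow> real) \<Rightarrow> real) \<Rightarrow> bool" where
  "A1 d v \<longleftrightarrow> A1_const d (cubes d) v < \<infinity>"

definition maxfun ::
  "nat \<Rightarrow> (nat \<Rightarrow> real) set set \<Rightarrow> ((nat \<Rightarrow> real) \<Rightarrow> real) \<Rightarrow> (nat \<Rightarrow> real) \<Rightarrow> ennreal" where
  "maxfun d \<E> g x = (SUP P\<in>\<E>. avg1 d P g * indicator P x)"

definition Ainf_const :: "nat \<Rightarrow> (nat \<Rightarrow> real) set set \<Rightarrow> ((nat \<Rightarrow> real) \<Rightarrow> real) \<Rightarrow> ennreal" where
  "Ainf_const d D v =
     (SUP Q\<in>D. (\<integral>\<^sup>+x\<in>Q. maxfun d (subcubes D Q) v x \<partial>leb d) / wmeasure d v Q)"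

definition Linf_norm :: "nat \<Rightarrow> ((nat \<Rightarrow> real) \<Rightarrow> real) \<Rightarrow> ((nat \<Rightarrow> real) \<Rightarrow> real) \<Rightarrow> ennreal" where
  "Linf_norm d w f = esssup (leb d) (\<lambda>x. ennreal \<bar>f x * w x\<bar>)"

definition Linf :: "nat \<Rightarrow> ((nat \<Rightarrow> real) \<Rightarrow> real) \<Rightarrow> ((nat \<Rightarrow> real) \<Rightarrow> real) set" where
  "Linf d w = {f \<in> borel_measurable (leb d). Linf_norm d w f < \<infinity>}"

text \<open>
  If a measurable \<open>f\<close> is not integrable on \<open>Q\<close>, then \<open>avg d Q f = 0\<close> and the mean oscillation
  \<open>avg1 d Q (\<lambda>x. f x - avg d Q f)\<close> is \<open>\<infinity>\<close>, so the totalised average never makes a norm small.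
\<close>

definition BMO1 ::
  "nat \<Rightarrow> (nat \<Rightarrow> real) set set \<Rightarrow> ((nat \<Rightarrow> real) \<Rightarrow> real) \<Rightarrow> ((nat \<Rightarrow> real) \<Rightarrow> real) \<Rightarrow> ennreal" where
  "BMO1 d D w f =
     (SUP Q\<in>D. avg1 d Q (\<lambda>x. f x - avg d Q f) / avg1 d Q (\<lambda>x. inverse (w x)))"

definition BMOinf ::
  "nat \<Rightarrow> (nat \<Rightarrow> real) set set \<Rightarrow> ((nat \<Rightarrow> real) \<Rightarrow> real) \<Rightarrow> ((nat \<Rightarrow> real) \<Rightarrow> real) \<Rightarrow> ennreal" where
  "BMOinf d D w f = (SUP Q\<in>D. avg_inf d Q w * avg1 d Q (\<lambda>x. f x - avg d Q f))"

definition BMO1_weak ::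
  "nat \<Rightarrow> (nat \<Rightarrow> real) set set \<Rightarrow> ((nat \<Rightarrow> real) \<Rightarrow> real) \<Rightarrow> ((nat \<Rightarrow> real) \<Rightarrow> real) \<Rightarrow> ennreal" where
  "BMO1_weak d D w f =
     (SUP Q\<in>D. INF c::real.
        weak_L1_norm d Q (\<lambda>x. (f x - c) * indicator Q x) / wmeasure d (\<lambda>x. inverse (w x)) Q)"

definition BMOinf_weak ::
  "nat \<Rightarrow> (nat \<Rightarrow> real) set set \<Rightarrow> ((nat \<Rightarrow> real) \<Rightarrow> real) \<Rightarrow> ((nat \<Rightarrow> real) \<Rightarrow> real) \<Rightarrow> ennreal" where
  "BMOinf_weak d D w f =
     (SUP Q\<in>D. INF c::real.
        avg_inf d Q w * inverse (emeasure (leb d) Q) *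
        weak_L1_norm d Q (\<lambda>x. (f x - c) * indicator Q x))"

text \<open>
  The sparse operator as a real-valued function. Under the hypotheses of the theorem the sum is finite
  almost everywhere (almost every point lies in finitely many cubes of \<open>\<S>\<close>, because
  \<open>\<Sum>|Q| < \<infinity>\<close>); on the exceptional null set \<open>enn2real\<close> gives the value 0.
\<close>

definition sparse_fun ::
  "nat \<Rightarrow> (nat \<Rightarrow> real) set set \<Rightarrow> ((nat \<Rightarrow> real) \<Rightarrow> real) \<Rightarrow> (nat \<Rightarrow> real) \<Rightarrow> real" where
  "sparse_fun d \<S> f x = enn2real (sparse_op d \<S> f x)"

end

theory Submission
  imports Defs
begin

text \<open>
  Write \<open>v = 1 / w\<close> and let \<open>K\<close> be the norm of \<open>f\<close>, so that \<open>\<bar>f\<bar> \<le> K v\<close> almost everywhere. Fix a cube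
  \<open>Q\<close> of the grid. On \<open>Q\<close> the sparse sum is a constant, coming from the finitely many cubes that
  strictly contain \<open>Q\<close>, plus a local part \<open>h\<close>, the sum over the cubes inside \<open>Q\<close>
  (\<open>sparse_op_split\<close>). The weak norms admit subtracting this constant, and in the strong
  norms it may replace the mean at the cost of a factor 2 (\<open>mean_oscillation_le\<close>), so only \<open>h\<close> has
  to be estimated on \<open>Q\<close>.

  For the strong norms, the integral of \<open>h\<close> is \<open>\<Sum> \<langle>f\<rangle>\<^sub>P \<bar>P\<bar> \<le> K \<Sum> \<langle>v\<rangle>\<^sub>P \<bar>P\<bar>\<close>. Replacing \<open>P\<close> by its disjoint
  core at the cost of \<open>1 / \<eta>\<close> turns this sum into at most the integral over \<open>Q\<close> of the maximal
  function of \<open>v\<close> localised to \<open>Q\<close>, and the \<open>A\<^sub>\<infinity>\<close> constant compares that integral with \<open>v(Q)\<close>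
  (\<open>integral_local_part_le\<close>).

  For the weak norms, the claim is a weak \<open>(1,1)\<close> bound for sparse operators whose constant is an
  absolute multiple of \<open>1 / \<eta>\<close> (\<open>weak_type_sparse_sum\<close>). As the constant may not depend on the
  dimension, and the ratio between consecutive cubes of the grid is unrestricted, a
  Calderon-Zygmund decomposition, with its doubling constant, is avoided. Instead the cubes are
  sorted into layers by the size of their averages. The overlap function of a layer is controlled
  in \<open>L\<^sup>2\<close> by the packing condition (\<open>integral_square_overlap_le\<close>), the union of the cubes of a layer
  by the maximal theorem (\<open>measure_Union_le_of_averages_ge\<close>), and the layers are added with
  geometric weights.

  The norms with \<open>\<langle>w\<rangle>\<^sub>\<infinity>\<close> follow from those with the inverse of \<open>\<langle>v\<rangle>\<^sub>1\<close>, since \<open>\<langle>v\<rangle>\<^sub>1 \<langle>w\<rangle>\<^sub>\<infinity>\<close> is at most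
  the \<open>A\<^sub>1\<close> constant.
\<close>

section \<open>Sums over countable families as integrals\<close>

text \<open>
  Sums over families of cubes are written as integrals against counting measure, so that the
  monotone convergence and Tonelli theorems apply to them.
\<close>

lemma infsum_ennreal_eq_nn_integral_count_space:
  fixes f :: "'a \<Rightarrow> ennreal"
  assumes "countable A"
  shows "(\<Sum>\<^sub>\<infinity>x\<in>A. f x) = (\<integral>\<^sup>+x. f x \<partial>count_space A)"
proof (cases "finite A")
  case True
  then show ?thesis by (simp add: nn_integral_count_space_finite)
next
  case False
  have bij: "bij_betw (from_nat_into A) UNIV A"
    using bij_betw_from_nat_into[OF assms False] .
  have "(\<lambda>n. f (from_nat_into A n)) summable_on UNIV"
    by (rule nonneg_summable_on_complete) simp
  then have "((\<lambda>n. f (from_nat_into A n)) has_sum (\<Sum>\<^sub>\<infinity>n. f (from_nat_into A n))) UNIV"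
    by (rule has_sum_infsum)
  then have "(\<lambda>n. f (from_nat_into A n)) sums (\<Sum>\<^sub>\<infinity>n. f (from_nat_into A n))"
    by (rule has_sum_imp_sums)
  then have "(\<Sum>\<^sub>\<infinity>n. f (from_nat_into A n)) = (\<Sum>n. f (from_nat_into A n))"
    by (simp add: sums_iff)
  then show ?thesis
    using nn_integral_bij_count_space[OF bij, of f]
    by (simp add: infsum_reindex_bij_betw[OF bij] nn_integral_count_space_nat)
qed

lemma finite_large_terms_of_infsum_ennreal:
  fixes f :: "'a \<Rightarrow> ennreal"
  assumes fin: "(\<Sum>\<^sub>\<infinity>x\<in>A. f x) < \<infinity>" and "c > 0"
  shows "finite {x \<in> A. c \<le> f x}"
proof (rule ccontr)
  assume inf: "infinite {x \<in> A. c \<le> f x}"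
  have "(\<Sum>\<^sub>\<infinity>x\<in>{x \<in> A. c \<le> f x}. f x) = \<infinity>"
    by (rule infsum_superconst_infinite_ennreal[OF _ \<open>c > 0\<close> inf]) auto
  moreover have "(\<Sum>\<^sub>\<infinity>x\<in>{x \<in> A. c \<le> f x}. f x) \<le> (\<Sum>\<^sub>\<infinity>x\<in>A. f x)"
    by (rule infsum_mono_neutral) (auto intro: nonneg_summable_on_complete)
  ultimately show False using fin by simp
qed

lemma countable_of_infsum_ennreal_finite:
  fixes f :: "'a \<Rightarrow> ennreal"
  assumes fin: "(\<Sum>\<^sub>\<infinity>x\<in>A. f x) < \<infinity>" and pos: "\<And>x. x \<in> A \<Longrightarrow> f x > 0"
  shows "countable A"
proof -
  have "A \<subseteq> (\<Union>n::nat. {x \<in> A. ennreal (inverse (real (Suc n))) \<le> f x})"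
  proof
    fix x assume x: "x \<in> A"
    have "\<exists>n. ennreal (inverse (real (Suc n))) \<le> f x"
    proof (cases "f x" rule: ennreal_cases)
      case (real r)
      then have "0 < r" using pos[OF x] by simp
      then obtain n where "inverse (real (Suc n)) < r" using reals_Archimedean by blast
      then show ?thesis unfolding real by (intro exI[of _ n] ennreal_leI) simp
    qed simp
    then show "x \<in> (\<Union>n::nat. {x \<in> A. ennreal (inverse (real (Suc n))) \<le> f x})"
      using x by auto
  qed
  moreover have "countable {x \<in> A. ennreal (inverse (real (Suc n))) \<le> f x}" for n
    by (intro countable_finite finite_large_terms_of_infsum_ennreal[OF fin]) simp
  ultimately show ?thesis
    by (meson countable_UN countable_subset countableI_type)
qed

lemma borel_measurable_nn_integral_count_space:
  fixes f :: "'i \<Rightarrow> 'a \<Rightarrow> ennreal"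
  assumes cnt: "countable I" and meas: "\<And>i. i \<in> I \<Longrightarrow> f i \<in> borel_measurable M"
  shows "(\<lambda>x. \<integral>\<^sup>+i. f i x \<partial>count_space I) \<in> borel_measurable M"
proof (cases "finite I")
  case True
  then show ?thesis using meas by (simp add: nn_integral_count_space_finite)
next
  case False
  note bij = bij_betw_from_nat_into[OF cnt False]
  have "(\<lambda>x. \<integral>\<^sup>+i. f i x \<partial>count_space I) = (\<lambda>x. \<Sum>n. f (from_nat_into I n) x)"
    by (simp add: nn_integral_bij_count_space[OF bij, symmetric] nn_integral_count_space_nat)
  moreover have "f (from_nat_into I n) \<in> borel_measurable M" for n
    using False by (intro meas from_nat_into) auto
  ultimately show ?thesis by simp
qed

lemma nn_integral_count_space_Collect:
  fixes f :: "'a \<Rightarrow> ennreal"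
  shows "(\<integral>\<^sup>+x. f x \<partial>count_space {x \<in> A. Q x}) = (\<integral>\<^sup>+x. f x * indicator {x. Q x} x \<partial>count_space A)"
  by (auto simp: nn_integral_count_space_indicator intro!: nn_integral_cong split: split_indicator)

section \<open>Laminar and sparse families in a measure space\<close>

text \<open>
  The order-theoretic content of a sparse collection of dyadic cubes: nestedness, and finitely many
  members above each one, so that maximal members exist in every subfamily.
\<close>

locale laminar_family =
  fixes M :: "'a measure" and S :: "'a set set"
  assumes countable_family: "countable S"
    and family_sets: "\<And>P. P \<in> S \<Longrightarrow> P \<in> sets M"
    and laminar: "\<And>P R. P \<in> S \<Longrightarrow> R \<in> S \<Longrightarrow> P \<inter> R \<noteq> {} \<Longrightarrow> P \<subseteq> R \<or> R \<subseteq> P"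
    and finite_supersets: "\<And>P. P \<in> S \<Longrightarrow> finite {R \<in> S. P \<subseteq> R}"
begin

text \<open>
  The weak \<open>(1,1)\<close> bound for the maximal operator of the family. The maximal members of \<open>T\<close> are
  disjoint and still cover \<open>\<Union>T\<close>, so the constant is 1.
\<close>

lemma measure_Union_le_of_averages_ge:
  assumes T: "T \<subseteq> S" "\<And>P. P \<in> T \<Longrightarrow> P \<subseteq> U" and U: "U \<in> sets M"
    and F[measurable]: "F \<in> borel_measurable M"
    and avg: "\<And>P. P \<in> T \<Longrightarrow> c * emeasure M P \<le> (\<integral>\<^sup>+x\<in>P. F x \<partial>M)"
  shows "c * emeasure M (\<Union>T) \<le> (\<integral>\<^sup>+x\<in>U. F x \<partial>M)"
proof -
  define Mx where "Mx = {P \<in> T. \<forall>R\<in>T. P \<subseteq> R \<longrightarrow> R = P}"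
  have sub: "Mx \<subseteq> S" "Mx \<subseteq> T" using T by (auto simp: Mx_def)
  have Mx_sets: "P \<in> sets M" if "P \<in> Mx" for P using that sub family_sets by auto
  have cnt: "countable Mx" by (rule countable_subset[OF sub(1) countable_family])
  have "\<exists>R\<in>Mx. P \<subseteq> R" if "P \<in> T" for P
  proof -
    have "finite {R \<in> T. P \<subseteq> R}"
      using that T(1) by (intro finite_subset[OF _ finite_supersets[of P]]) auto
    from finite_has_maximal2[OF this, of P] that
    obtain R where R: "R \<in> T" "P \<subseteq> R" "\<forall>R'\<in>{R \<in> T. P \<subseteq> R}. R \<subseteq> R' \<longrightarrow> R = R'" by auto
    then have "R \<in> Mx" by (auto simp: Mx_def)
    with R show ?thesis by auto
  qed
  then have eq: "\<Union>T = (\<Union>P\<in>Mx. P)" using sub by blast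
  have disj: "disjoint_family_on (\<lambda>P. P) Mx"
    unfolding disjoint_family_on_def
  proof (intro ballI impI)
    fix P R assume PR: "P \<in> Mx" "R \<in> Mx" "P \<noteq> R"
    show "P \<inter> R = {}"
    proof (rule ccontr)
      assume "P \<inter> R \<noteq> {}"
      then have "P \<subseteq> R \<or> R \<subseteq> P" using PR sub(1) by (intro laminar) auto
      with PR show False by (auto simp: Mx_def)
    qed
  qed
  have "c * emeasure M (\<Union>T) = c * (\<integral>\<^sup>+P. emeasure M P \<partial>count_space Mx)"
    unfolding eq using Mx_sets by (subst emeasure_UN_countable[OF _ cnt disj]) auto
  also have "\<dots> = (\<integral>\<^sup>+P. c * emeasure M P \<partial>count_space Mx)"
    by (rule nn_integral_cmult[symmetric]) simp
  also have "\<dots> \<le> (\<integral>\<^sup>+P. emeasure (density M F) P \<partial>count_space Mx)"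
    using avg sub Mx_sets by (intro nn_integral_mono) (auto simp: emeasure_density)
  also have "\<dots> = emeasure (density M F) (\<Union>P\<in>Mx. P)"
    using Mx_sets by (subst emeasure_UN_countable[OF _ cnt disj]) auto
  also have "\<dots> \<le> emeasure (density M F) U"
    using T sub U by (intro emeasure_mono) auto
  also have "\<dots> = (\<integral>\<^sup>+x\<in>U. F x \<partial>M)"
    using U by (simp add: emeasure_density)
  finally show ?thesis .
qed

end

locale sparse_family = laminar_family +
  fixes E :: "'a set \<Rightarrow> 'a set" and \<eta> :: real
  assumes ratio_pos: "0 < \<eta>"
    and core_disjoint: "disjoint_family_on E S"
    and core_sets: "\<And>P. P \<in> S \<Longrightarrow> E P \<in> sets M"
    and core_subset: "\<And>P. P \<in> S \<Longrightarrow> E P \<subseteq> P"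
    and core_large: "\<And>P. P \<in> S \<Longrightarrow> ennreal \<eta> * emeasure M P \<le> emeasure M (E P)"
begin

text \<open>
  The basic use of sparseness: replace each \<open>P\<close> by its core \<open>E P\<close> at the cost of a factor \<open>\<eta>\<close>. As
  the cores are disjoint, at most one coefficient is active at each point, and there it is below
  \<open>F\<close>.
\<close>

lemma sparse_sum_le_integral:
  assumes T: "T \<subseteq> S" "\<And>P. P \<in> T \<Longrightarrow> P \<subseteq> U"
    and le: "\<And>P x. P \<in> T \<Longrightarrow> x \<in> P \<Longrightarrow> a P \<le> F x"
  shows "ennreal \<eta> * (\<integral>\<^sup>+P. a P * emeasure M P \<partial>count_space T) \<le> (\<integral>\<^sup>+x\<in>U. F x \<partial>M)"
proof -
  have cnt: "countable T" by (rule countable_subset[OF T(1) countable_family])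
  have "ennreal \<eta> * (\<integral>\<^sup>+P. a P * emeasure M P \<partial>count_space T)
      = (\<integral>\<^sup>+P. a P * (ennreal \<eta> * emeasure M P) \<partial>count_space T)"
    by (subst nn_integral_cmult[symmetric]) (auto simp: ac_simps)
  also have "\<dots> \<le> (\<integral>\<^sup>+P. a P * emeasure M (E P) \<partial>count_space T)"
    using T core_large by (intro nn_integral_mono mult_left_mono) auto
  also have "\<dots> = (\<integral>\<^sup>+P. \<integral>\<^sup>+x. a P * indicator (E P) x \<partial>M \<partial>count_space T)"
    using T core_sets by (intro nn_integral_cong) (auto simp: nn_integral_cmult_indicator)
  also have "\<dots> = (\<integral>\<^sup>+x. \<integral>\<^sup>+P. a P * indicator (E P) x \<partial>count_space T \<partial>M)"
    using T core_sets by (intro nn_integral_count_space_nn_integral[symmetric] cnt) auto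
  also have "\<dots> \<le> (\<integral>\<^sup>+x\<in>U. F x \<partial>M)"
  proof (rule nn_integral_mono)
    fix x
    show "(\<integral>\<^sup>+P. a P * indicator (E P) x \<partial>count_space T) \<le> F x * indicator U x"
    proof (cases "\<exists>P\<in>T. x \<in> E P")
      case True
      then obtain P where P: "P \<in> T" "x \<in> E P" by auto
      then have xU: "x \<in> P" "x \<in> U" using T core_subset by blast+
      have "a R * indicator (E R) x \<le> F x * indicator {P} R" if "R \<in> T" for R
      proof (cases "R = P")
        case True
        then show ?thesis using le[OF P(1) xU(1)] P(2) by simp
      next
        case False
        then have "E R \<inter> E P = {}"
          using core_disjoint that P(1) T(1) by (auto simp: disjoint_family_on_def)
        then show ?thesis using P(2) by (auto simp: indicator_def)
      qed
      then have "(\<integral>\<^sup>+R. a R * indicator (E R) x \<partial>count_space T)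
          \<le> (\<integral>\<^sup>+R. F x * indicator {P} R \<partial>count_space T)"
        by (intro nn_integral_mono) auto
      also have "\<dots> = F x" using P by (subst nn_integral_cmult_indicator) auto
      finally show ?thesis using xU by simp
    next
      case False
      then have "(\<integral>\<^sup>+R. a R * indicator (E R) x \<partial>count_space T) = (\<integral>\<^sup>+R. 0 \<partial>count_space T)"
        by (intro nn_integral_cong) auto
      then show ?thesis by simp
    qed
  qed
  finally show ?thesis .
qed

text \<open>The Carleson packing condition.\<close>

lemma sparse_sum_measure_le:
  assumes T: "T \<subseteq> S" "\<And>P. P \<in> T \<Longrightarrow> P \<subseteq> U" and U: "U \<in> sets M"
  shows "ennreal \<eta> * (\<integral>\<^sup>+P. emeasure M P \<partial>count_space T) \<le> emeasure M U"
proof -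
  have "ennreal \<eta> * (\<integral>\<^sup>+P. 1 * emeasure M P \<partial>count_space T) \<le> (\<integral>\<^sup>+x\<in>U. 1 \<partial>M)"
    by (rule sparse_sum_le_integral[OF T order_refl])
  then show ?thesis using U by simp
qed

text \<open>
  Squaring the overlap function gives a double sum over pairs of members meeting at a point. Such
  pairs are nested, so up to a factor 2 one sums over \<open>R \<subseteq> P\<close>; the packing condition is then applied
  once inside each \<open>P\<close> and once inside \<open>\<Union>T\<close>, which accounts for the two factors \<open>\<eta>\<close>.
\<close>

lemma integral_square_overlap_le:
  assumes T: "T \<subseteq> S"
  shows "ennreal \<eta> * (ennreal \<eta> * (\<integral>\<^sup>+x. (\<integral>\<^sup>+P. indicator P x \<partial>count_space T)\<^sup>2 \<partial>M))
       \<le> 2 * emeasure M (\<Union>T)"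
proof -
  have cnt: "countable T" by (rule countable_subset[OF T countable_family])
  have Ts: "P \<in> sets M" if "P \<in> T" for P using that T family_sets by auto
  have US: "\<Union>T \<in> sets M" using Ts cnt by (intro sets.countable_Union) auto
  define G where "G x = (\<integral>\<^sup>+P. \<integral>\<^sup>+R. indicator R x \<partial>count_space {R \<in> T. R \<subseteq> P} \<partial>count_space T)"
    for x :: 'a
  have G: "G x = (\<integral>\<^sup>+P. \<integral>\<^sup>+R. indicator R x * indicator {R. R \<subseteq> P} R \<partial>count_space T \<partial>count_space T)" for x
    unfolding G_def by (intro nn_integral_cong nn_integral_count_space_Collect)
  also have "\<dots> x = (\<integral>\<^sup>+R. \<integral>\<^sup>+P. indicator R x * indicator {R. R \<subseteq> P} R \<partial>count_space T \<partial>count_space T)" for x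
    by (rule nn_integral_count_space_nn_integral[OF cnt]) simp
  finally have G': "G x = (\<integral>\<^sup>+P. \<integral>\<^sup>+R. indicator P x * indicator {P. P \<subseteq> R} P \<partial>count_space T \<partial>count_space T)" for x .
  have sq: "(\<integral>\<^sup>+P. indicator P x \<partial>count_space T)\<^sup>2 \<le> 2 * G x" for x
  proof -
    have "(\<integral>\<^sup>+P. indicator P x \<partial>count_space T)\<^sup>2 =
      (\<integral>\<^sup>+P. \<integral>\<^sup>+R. indicator P x * indicator R x \<partial>count_space T \<partial>count_space T)"
      by (simp add: power2_eq_square nn_integral_cmult nn_integral_multc)
    also have "\<dots> \<le> (\<integral>\<^sup>+P. \<integral>\<^sup>+R. indicator R x * indicator {R. R \<subseteq> P} R
         + indicator P x * indicator {P. P \<subseteq> R} P \<partial>count_space T \<partial>count_space T)"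
    proof (intro nn_integral_mono)
      fix P R assume "P \<in> space (count_space T)" "R \<in> space (count_space T)"
      then have "x \<in> P \<Longrightarrow> x \<in> R \<Longrightarrow> P \<subseteq> R \<or> R \<subseteq> P"
        using T by (intro laminar) auto
      then show "indicator P x * indicator R x
          \<le> indicator R x * indicator {R. R \<subseteq> P} R + indicator P x * (indicator {P. P \<subseteq> R} P::ennreal)"
        by (cases "x \<in> P"; cases "x \<in> R"; cases "P \<subseteq> R"; cases "R \<subseteq> P") simp_all
    qed
    also have "\<dots> = G x + G x"
      by (subst (2) G', unfold G) (simp add: nn_integral_add)
    finally show ?thesis by (simp add: mult_2)
  qed
  have meas: "(\<lambda>x. \<integral>\<^sup>+R. indicator R x \<partial>count_space {R \<in> T. R \<subseteq> P}) \<in> borel_measurable M" for P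
    using Ts by (intro borel_measurable_nn_integral_count_space countable_subset[OF _ cnt]) auto
  have "(\<integral>\<^sup>+x. G x \<partial>M)
      = (\<integral>\<^sup>+P. \<integral>\<^sup>+x. \<integral>\<^sup>+R. indicator R x \<partial>count_space {R \<in> T. R \<subseteq> P} \<partial>M \<partial>count_space T)"
    unfolding G_def by (intro nn_integral_count_space_nn_integral cnt meas)
  also have "\<dots> = (\<integral>\<^sup>+P. \<integral>\<^sup>+R. \<integral>\<^sup>+x. indicator R x \<partial>M \<partial>count_space {R \<in> T. R \<subseteq> P} \<partial>count_space T)"
    using Ts by (intro nn_integral_cong nn_integral_count_space_nn_integral countable_subset[OF _ cnt]) auto
  also have "\<dots> = (\<integral>\<^sup>+P. \<integral>\<^sup>+R. emeasure M R \<partial>count_space {R\<in>T. R \<subseteq> P} \<partial>count_space T)"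
    using Ts by (intro nn_integral_cong) simp
  finally have intG: "(\<integral>\<^sup>+x. G x \<partial>M) = \<dots>" .
  have "(\<integral>\<^sup>+x. (\<integral>\<^sup>+P. indicator P x \<partial>count_space T)\<^sup>2 \<partial>M) \<le> (\<integral>\<^sup>+x. 2 * G x \<partial>M)"
    by (intro nn_integral_mono sq)
  also have "\<dots> = 2 * (\<integral>\<^sup>+x. G x \<partial>M)"
    unfolding G_def
    by (intro nn_integral_cmult borel_measurable_nn_integral_count_space[of T] cnt meas)
  finally have 1: "(\<integral>\<^sup>+x. (\<integral>\<^sup>+P. indicator P x \<partial>count_space T)\<^sup>2 \<partial>M)
     \<le> 2 * (\<integral>\<^sup>+P. \<integral>\<^sup>+R. emeasure M R \<partial>count_space {R\<in>T. R \<subseteq> P} \<partial>count_space T)"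
    unfolding intG .
  have 2: "ennreal \<eta> * (\<integral>\<^sup>+R. emeasure M R \<partial>count_space {R\<in>T. R \<subseteq> P}) \<le> emeasure M P" if "P \<in> T" for P
    by (rule sparse_sum_measure_le) (use T Ts[OF that] in auto)
  have 3: "ennreal \<eta> * (\<integral>\<^sup>+P. emeasure M P \<partial>count_space T) \<le> emeasure M (\<Union>T)"
    by (rule sparse_sum_measure_le) (use T US in auto)
  have "ennreal \<eta> * (\<integral>\<^sup>+P. \<integral>\<^sup>+R. emeasure M R \<partial>count_space {R\<in>T. R \<subseteq> P} \<partial>count_space T)
     = (\<integral>\<^sup>+P. ennreal \<eta> * (\<integral>\<^sup>+R. emeasure M R \<partial>count_space {R\<in>T. R \<subseteq> P}) \<partial>count_space T)"
    by (rule nn_integral_cmult[symmetric]) simp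
  also have "\<dots> \<le> (\<integral>\<^sup>+P. emeasure M P \<partial>count_space T)"
    by (intro nn_integral_mono 2) auto
  finally have 4: "ennreal \<eta> * (ennreal \<eta> * (\<integral>\<^sup>+P. \<integral>\<^sup>+R. emeasure M R \<partial>count_space {R\<in>T. R \<subseteq> P} \<partial>count_space T))
     \<le> emeasure M (\<Union>T)"
    using 3 by (meson mult_left_mono order_trans zero_le)
  have "ennreal \<eta> * (ennreal \<eta> * (\<integral>\<^sup>+x. (\<integral>\<^sup>+P. indicator P x \<partial>count_space T)\<^sup>2 \<partial>M))
   \<le> ennreal \<eta> * (ennreal \<eta> * (2 * (\<integral>\<^sup>+P. \<integral>\<^sup>+R. emeasure M R \<partial>count_space {R\<in>T. R \<subseteq> P} \<partial>count_space T)))"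
    by (intro mult_left_mono 1) auto
  also have "\<dots> = 2 * (ennreal \<eta> * (ennreal \<eta> * (\<integral>\<^sup>+P. \<integral>\<^sup>+R. emeasure M R \<partial>count_space {R\<in>T. R \<subseteq> P} \<partial>count_space T)))"
    by (simp add: ac_simps)
  also have "\<dots> \<le> 2 * emeasure M (\<Union>T)" by (intro mult_left_mono 4) auto
  finally show ?thesis .
qed

section \<open>The weak-type estimate\<close>

text \<open>
  Members with coefficient above \<open>s = \<eta> t\<close> cover a set of measure at most \<open>J / s\<close>, where \<open>J\<close> is the
  integral of \<open>F\<close> over \<open>U\<close>; this set is discarded. The other members are sorted into layers by the
  thresholds \<open>s / 4\<^sup>k\<^sup>+\<^sup>1\<close> for \<open>a P\<close>. The overlap \<open>N k\<close> of the layer \<open>k\<close> is weighted by \<open>s / 4\<^sup>k\<close> and lives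
  on a set of measure at most \<open>4\<^sup>k\<^sup>+\<^sup>1 J / s\<close>. With first moments of \<open>N k\<close> the weighted overlaps and the
  measures of the exceptional sets cannot both be summable in \<open>k\<close>; the second moment leaves room:
  allowing \<open>N k\<close> to be as large as \<open>3\<^sup>k / (4 \<eta>)\<close> keeps the total at most \<open>t\<close> because \<open>3 < 4\<close>, and the
  measures are summable by Chebyshev's inequality because \<open>4 < 3\<^sup>2\<close>.
\<close>

lemma weak_type_sparse_sum:
  assumes T: "T \<subseteq> S" "\<And>P. P \<in> T \<Longrightarrow> P \<subseteq> U" and U: "U \<in> sets M"
    and F: "F \<in> borel_measurable M"
    and avg: "\<And>P. P \<in> T \<Longrightarrow> a P * emeasure M P \<le> (\<integral>\<^sup>+x\<in>P. F x \<partial>M)"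
    and t: "0 < t"
  shows "ennreal t * emeasure M {x \<in> U. ennreal t < (\<integral>\<^sup>+P. a P * indicator P x \<partial>count_space T)}
    \<le> ennreal (232 / \<eta>) * (\<integral>\<^sup>+x\<in>U. F x \<partial>M)"
proof -
  define J where "J = (\<integral>\<^sup>+x\<in>U. F x \<partial>M)"
  define s where "s = \<eta> * t"
  have s: "0 < s" using t ratio_pos by (simp add: s_def)
  have cnt: "countable T" by (rule countable_subset[OF T(1) countable_family])
  have Ts: "P \<in> sets M" if "P \<in> T" for P using that T family_sets by auto
  have Us: "\<Union>T' \<in> sets M" if "T' \<subseteq> T" for T'
    using Ts that countable_subset[OF that cnt] by (intro sets.countable_Union) auto
  have cover: "ennreal c * emeasure M (\<Union>{P \<in> T. ennreal c < a P}) \<le> J" for c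
    unfolding J_def
  proof (rule measure_Union_le_of_averages_ge[OF _ _ U F])
    fix P assume P: "P \<in> {P \<in> T. ennreal c < a P}"
    then have "ennreal c * emeasure M P \<le> a P * emeasure M P"
      by (intro mult_right_mono) auto
    with avg[of P] P show "ennreal c * emeasure M P \<le> (\<integral>\<^sup>+x\<in>P. F x \<partial>M)"
      by (auto intro: order_trans)
  qed (use T in auto)
  define peak where "peak = \<Union>{P \<in> T. ennreal s < a P}"
  \<comment> \<open>The layers are nested: each contains all members above its threshold. A member with a
    nonzero coefficient is charged to the first layer that contains it.\<close>
  define layer where "layer k = {P \<in> T. ennreal (s / 4 ^ Suc k) < a P}" for k
  define N where "N k x = (\<integral>\<^sup>+P. indicator P x \<partial>count_space (layer k))" for k x
  define B where "B k = {x \<in> space M. ennreal (3 ^ k / (4 * \<eta>)) < N k x}" for k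
  have layer: "layer k \<subseteq> T" for k by (auto simp: layer_def)
  have N[measurable]: "N k \<in> borel_measurable M" for k
    unfolding N_def using Ts subsetD[OF layer[of k]]
    by (intro borel_measurable_nn_integral_count_space countable_subset[OF layer cnt]) auto
  have B_sets: "B k \<in> sets M" for k unfolding B_def by measurable
  have peak_sets: "peak \<in> sets M" unfolding peak_def by (rule Us) auto
  have scale: "ennreal d * X \<le> ennreal (d / c) * Y" if "ennreal c * X \<le> Y" "0 < c" "0 < d" for c d X Y
  proof -
    have "ennreal d * X = ennreal (d / c) * (ennreal c * X)"
      using that by (simp add: mult.assoc[symmetric] ennreal_mult[symmetric])
    also have "\<dots> \<le> ennreal (d / c) * Y" using that by (intro mult_left_mono) auto
    finally show ?thesis .
  qed
  \<comment> \<open>Off the exceptional sets the total is at most the sum of \<open>(s / 4^k) * (3^k / (4 * \<eta>))\<close>,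
    a geometric series with sum \<open>t\<close>.\<close>
  have incl: "{x \<in> U. ennreal t < (\<integral>\<^sup>+P. a P * indicator P x \<partial>count_space T)} \<subseteq> peak \<union> (\<Union>k. B k)"
  proof (rule subsetI, rule ccontr)
    fix x assume x: "x \<in> {x \<in> U. ennreal t < (\<integral>\<^sup>+P. a P * indicator P x \<partial>count_space T)}"
      and nx: "x \<notin> peak \<union> (\<Union>k. B k)"
    have "x \<in> space M" using x U sets.sets_into_space by auto
    then have small: "N k x \<le> ennreal (3 ^ k / (4 * \<eta>))" for k
      using nx by (auto simp: B_def not_less)
    have term_le: "a P * indicator P x
        \<le> (\<Sum>k. ennreal (s / 4 ^ k) * (indicator P x * indicator {P. ennreal (s / 4 ^ Suc k) < a P} P))"
      if P: "P \<in> T" for P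
    proof (cases "x \<in> P \<and> a P \<noteq> 0")
      case True
      then have le: "a P \<le> ennreal s" using nx P by (auto simp: peak_def not_less)
      then obtain r where r: "a P = ennreal r" "0 < r"
        using True by (cases "a P" rule: ennreal_cases) (auto simp: top_unique less_le)
      obtain m where "(1 / 4) ^ m < r / s"
        using real_arch_pow_inv[of "r / s" "1 / 4"] r s by auto
      then have "s / 4 ^ Suc m < r"
        using s r by (simp add: field_simps power_divide)
      then have ex: "ennreal (s / 4 ^ Suc m) < a P" using r by (simp add: ennreal_less_iff s less_imp_le)
      define k where "k = (LEAST k. ennreal (s / 4 ^ Suc k) < a P)"
      have k1: "ennreal (s / 4 ^ Suc k) < a P" unfolding k_def using ex by (rule LeastI)
      have k2: "a P \<le> ennreal (s / 4 ^ k)"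
      proof (cases k)
        case 0 then show ?thesis using le by simp
      next
        case (Suc j)
        then have "\<not> ennreal (s / 4 ^ Suc j) < a P"
          using not_less_Least[of j "\<lambda>k. ennreal (s / 4 ^ Suc k) < a P"] by (simp add: k_def)
        then show ?thesis unfolding Suc by (simp add: not_less)
      qed
      have "a P * indicator P x
          \<le> ennreal (s / 4 ^ k) * (indicator P x * indicator {P. ennreal (s / 4 ^ Suc k) < a P} P)"
        using True k1 k2 by simp
      also have "\<dots> \<le> (\<Sum>k. ennreal (s / 4 ^ k) * (indicator P x * indicator {P. ennreal (s / 4 ^ Suc k) < a P} P))"
        using sum_le_suminf[of "\<lambda>k. ennreal (s / 4 ^ k) * (indicator P x * indicator {P. ennreal (s / 4 ^ Suc k) < a P} P)" "{k}"]
        by simp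
      finally show ?thesis .
    qed auto
    have "(\<integral>\<^sup>+P. a P * indicator P x \<partial>count_space T)
      \<le> (\<integral>\<^sup>+P. (\<Sum>k. ennreal (s / 4 ^ k) * (indicator P x * indicator {P. ennreal (s / 4 ^ Suc k) < a P} P)) \<partial>count_space T)"
      by (intro nn_integral_mono term_le) simp
    also have "\<dots> = (\<Sum>k. \<integral>\<^sup>+P. ennreal (s / 4 ^ k) * (indicator P x * indicator {P. ennreal (s / 4 ^ Suc k) < a P} P) \<partial>count_space T)"
      by (rule nn_integral_suminf) simp
    also have "\<dots> = (\<Sum>k. ennreal (s / 4 ^ k) * N k x)"
      unfolding N_def layer_def nn_integral_count_space_Collect
      by (intro suminf_cong nn_integral_cmult) simp
    also have "\<dots> \<le> (\<Sum>k. ennreal (t / 4 * (3 / 4) ^ k))"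
    proof (intro suminf_le)
      fix k
      have "ennreal (s / 4 ^ k) * N k x \<le> ennreal (s / 4 ^ k) * ennreal (3 ^ k / (4 * \<eta>))"
        by (intro mult_left_mono small) auto
      also have "\<dots> = ennreal (t / 4 * (3 / 4) ^ k)"
        using ratio_pos t by (simp add: s_def ennreal_mult[symmetric] power_divide field_simps)
      finally show "ennreal (s / 4 ^ k) * N k x \<le> ennreal (t / 4 * (3 / 4) ^ k)" .
    qed auto
    also have "\<dots> = ennreal t"
      using sums_mult[OF geometric_sums[of "3/4::real"], of "t / 4"] t
      by (intro suminf_ennreal_eq) auto
    finally show False using x by auto
  qed
  \<comment> \<open>Chebyshev with the second moment, then the covering bound for the union of the layer.\<close>
  have B_small: "ennreal t * emeasure M (B k) \<le> ennreal (128 / \<eta> * (4 / 9) ^ k) * J" for k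
  proof -
    define c where "c = 3 ^ k / (4 * \<eta>)"
    have c: "0 < c" using ratio_pos by (simp add: c_def)
    have "ennreal (c\<^sup>2) * emeasure M (B k) = (\<integral>\<^sup>+x. ennreal (c\<^sup>2) * indicator (B k) x \<partial>M)"
      using B_sets by (simp add: nn_integral_cmult_indicator)
    also have "\<dots> \<le> (\<integral>\<^sup>+x. (N k x)\<^sup>2 \<partial>M)"
    proof (rule nn_integral_mono)
      fix x
      have "ennreal (c\<^sup>2) \<le> (N k x)\<^sup>2" if "x \<in> B k"
        using that c power_mono[of "ennreal c" "N k x" 2] unfolding B_def c_def[symmetric]
        by (simp add: ennreal_power less_imp_le)
      then show "ennreal (c\<^sup>2) * indicator (B k) x \<le> (N k x)\<^sup>2" by (auto simp: indicator_def)
    qed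
    finally have cheb: "ennreal (c\<^sup>2) * emeasure M (B k) \<le> (\<integral>\<^sup>+x. (N k x)\<^sup>2 \<partial>M)" .
    have "ennreal \<eta> * (ennreal \<eta> * (ennreal (c\<^sup>2) * emeasure M (B k)))
        \<le> ennreal \<eta> * (ennreal \<eta> * (\<integral>\<^sup>+x. (N k x)\<^sup>2 \<partial>M))"
      by (intro mult_left_mono cheb) auto
    also have "\<dots> \<le> 2 * emeasure M (\<Union>(layer k))"
      unfolding N_def by (rule integral_square_overlap_le) (use layer T in blast)
    also have "\<dots> \<le> 2 * (ennreal (4 ^ Suc k / s) * J)"
      using scale[OF cover[of "s / 4 ^ Suc k"], of 1] s
      by (intro mult_left_mono) (auto simp: layer_def)
    also have "\<dots> = ennreal (2 * 4 ^ Suc k / s) * J"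
      using s ennreal_mult[of 2 "4 ^ Suc k / s"] by (simp add: mult.assoc)
    finally have *: "ennreal (\<eta> * \<eta> * c\<^sup>2) * emeasure M (B k) \<le> ennreal (2 * 4 ^ Suc k / s) * J"
      using ratio_pos s by (simp add: ennreal_mult' mult.assoc)
    have "ennreal t * emeasure M (B k) \<le> ennreal (t / (\<eta> * \<eta> * c\<^sup>2)) * (ennreal (2 * 4 ^ Suc k / s) * J)"
      using ratio_pos c t by (intro scale[OF *]) auto
    also have "\<dots> = ennreal (t / (\<eta> * \<eta> * c\<^sup>2) * (2 * 4 ^ Suc k / s)) * J"
      using ratio_pos c t s by (subst ennreal_mult) (auto simp: mult.assoc)
    also have "t / (\<eta> * \<eta> * c\<^sup>2) * (2 * 4 ^ Suc k / s) = 128 / \<eta> * (4 / 9) ^ k"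
    proof -
      have "(3 ^ k)\<^sup>2 = (9::real) ^ k" by (simp add: power2_eq_square flip: power_mult_distrib)
      then show ?thesis using ratio_pos t
        by (simp add: c_def s_def power_divide power_mult_distrib field_simps power2_eq_square)
    qed
    finally show ?thesis .
  qed
  have "ennreal t * emeasure M {x \<in> U. ennreal t < (\<integral>\<^sup>+P. a P * indicator P x \<partial>count_space T)}
      \<le> ennreal t * (emeasure M peak + (\<Sum>k. emeasure M (B k)))"
  proof (rule mult_left_mono)
    have "emeasure M {x \<in> U. ennreal t < (\<integral>\<^sup>+P. a P * indicator P x \<partial>count_space T)}
       \<le> emeasure M (peak \<union> (\<Union>k. B k))"
      using incl peak_sets B_sets by (intro emeasure_mono) auto
    also have "\<dots> \<le> emeasure M peak + emeasure M (\<Union>k. B k)"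
      using peak_sets B_sets by (intro emeasure_subadditive) auto
    also have "\<dots> \<le> emeasure M peak + (\<Sum>k. emeasure M (B k))"
      using B_sets by (intro add_left_mono emeasure_subadditive_countably) auto
    finally show "emeasure M {x \<in> U. ennreal t < (\<integral>\<^sup>+P. a P * indicator P x \<partial>count_space T)} \<le> \<dots>" .
  qed simp
  also have "\<dots> = ennreal t * emeasure M peak + (\<Sum>k. ennreal t * emeasure M (B k))"
    by (simp add: distrib_left)
  also have "\<dots> \<le> ennreal (1 / \<eta>) * J + (\<Sum>k. ennreal (128 / \<eta> * (4 / 9) ^ k) * J)"
  proof (intro add_mono suminf_le B_small)
    show "ennreal t * emeasure M peak \<le> ennreal (1 / \<eta>) * J"
      using scale[OF cover[of s], of t] s t by (simp add: peak_def s_def)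
  qed auto
  also have "(\<Sum>k. ennreal (128 / \<eta> * (4 / 9) ^ k) * J) = ennreal (128 / \<eta> * (9 / 5)) * J"
    using sums_mult[OF geometric_sums[of "4/9::real"], of "128 / \<eta>"] ratio_pos
    by (subst ennreal_suminf_multc, subst suminf_ennreal_eq) auto
  also have "ennreal (1 / \<eta>) * J + ennreal (128 / \<eta> * (9 / 5)) * J
      = ennreal (1 / \<eta> + 128 / \<eta> * (9 / 5)) * J"
    using ratio_pos by (subst ennreal_plus) (auto simp: distrib_right)
  \<comment> \<open>\<open>1 + 128 * 9 / 5 = 231.4\<close>\<close>
  also have "\<dots> \<le> ennreal (232 / \<eta>) * J"
    using ratio_pos by (intro mult_right_mono ennreal_leI) (auto simp: field_simps)
  finally show ?thesis unfolding J_def .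
qed

end

section \<open>Cubes and mean oscillation\<close>

lemma ennreal_divide_mult_le: "(a / b) * b \<le> (a::ennreal)"
  by (cases "b = 0 \<or> b = top")
    (auto simp: ennreal_divide_times ennreal_divide_self less_top)

lemma sets_leb_cube: "Q \<in> cubes d \<Longrightarrow> Q \<in> sets (leb d)"
  unfolding cubes_def leb_def by (auto intro!: sets_completionI_sets sets_PiM_I_finite)

lemma emeasure_leb_cube:
  assumes "Q \<in> cubes d"
  shows "0 < emeasure (leb d) Q" "emeasure (leb d) Q < \<infinity>"
proof -
  interpret product_sigma_finite "\<lambda>_::nat. lborel :: real measure" by standard
  obtain a l where Q: "Q = PiE {..<d} (\<lambda>i. {a i..<a i + l})" and l: "0 < l"
    using assms by (auto simp: cubes_def)
  have "Q \<in> sets (PiM {..<d} (\<lambda>_. lborel))"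
    unfolding Q by (auto intro!: sets_PiM_I_finite)
  then have "emeasure (leb d) Q = emeasure (PiM {..<d} (\<lambda>_. lborel)) Q"
    unfolding leb_def by simp
  also have "\<dots> = (\<Prod>i<d. emeasure lborel {a i..<a i + l})"
    unfolding Q by (rule emeasure_PiM) auto
  also have "\<dots> = ennreal (l ^ d)"
    using l by (simp add: ennreal_power)
  finally show "0 < emeasure (leb d) Q" "emeasure (leb d) Q < \<infinity>"
    using l by auto
qed

text \<open>
  Comparing with an arbitrary constant instead of the mean costs a factor 2. If \<open>g - c\<close> is not
  integrable on \<open>Q\<close> the right-hand side is infinite; otherwise the mean of \<open>g\<close> is a true average.
\<close>

lemma mean_oscillation_le:
  assumes g: "g \<in> borel_measurable (leb d)" and Q: "Q \<in> cubes d"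
  shows "avg1 d Q (\<lambda>x. g x - avg d Q g) \<le> 2 * avg1 d Q (\<lambda>x. g x - c)"
proof (cases "avg1 d Q (\<lambda>x. g x - c) = top")
  case True
  then show ?thesis by (simp add: ennreal_mult_top)
next
  case False
  have [measurable]: "Q \<in> sets (leb d)" using Q by (rule sets_leb_cube)
  note m = emeasure_leb_cube[OF Q]
  define m where "m = measure (leb d) Q"
  have em: "emeasure (leb d) Q = ennreal m" using m by (simp add: m_def emeasure_eq_ennreal_measure)
  have mpos: "m > 0" using m em by simp
  have fin: "(\<integral>\<^sup>+x\<in>Q. ennreal \<bar>g x - c\<bar> \<partial>leb d) < \<infinity>"
    using False m by (auto simp: avg1_def ennreal_divide_eq_top_iff less_top)
  have int_gc: "set_integrable (leb d) Q (\<lambda>x. g x - c)"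
    unfolding set_integrable_def
  proof (rule integrableI_bounded)
    show "(\<lambda>x. indicat_real Q x *\<^sub>R (g x - c)) \<in> borel_measurable (leb d)" using g by measurable
    have "(\<integral>\<^sup>+x. ennreal (norm (indicat_real Q x *\<^sub>R (g x - c))) \<partial>leb d) = (\<integral>\<^sup>+x\<in>Q. ennreal \<bar>g x - c\<bar> \<partial>leb d)"
      by (intro nn_integral_cong) (auto simp: indicator_def)
    then show "(\<integral>\<^sup>+x. ennreal (norm (indicat_real Q x *\<^sub>R (g x - c))) \<partial>leb d) < \<infinity>" using fin by simp
  qed
  have int_c: "set_integrable (leb d) Q (\<lambda>x. c)"
    unfolding set_integrable_def using m by (intro integrable_scaleR_left) simp
  have int_g: "set_integrable (leb d) Q g"
    using set_integral_add(1)[OF int_gc int_c] by simp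
  have diff: "avg d Q g - c = (LINT x:Q|leb d. g x - c) / m"
  proof -
    have "(LINT x:Q|leb d. g x - c) = (LINT x:Q|leb d. g x) - c * m"
      using set_integral_diff(2)[OF int_g int_c] m
      by (simp add: m_def set_integral_const set_lebesgue_integral_def)
    then show ?thesis using mpos by (simp add: avg_def m_def[symmetric] field_simps)
  qed
  define I where "I = (LINT x:Q|leb d. \<bar>g x - c\<bar>)"
  have I: "(\<integral>\<^sup>+x\<in>Q. ennreal \<bar>g x - c\<bar> \<partial>leb d) = ennreal I"
  proof -
    have "(\<integral>\<^sup>+x\<in>Q. ennreal \<bar>g x - c\<bar> \<partial>leb d) = (\<integral>\<^sup>+x. ennreal (indicat_real Q x *\<^sub>R \<bar>g x - c\<bar>) \<partial>leb d)"
      by (intro nn_integral_cong) (auto simp: indicator_def)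
    also have "\<dots> = ennreal I"
      unfolding I_def set_lebesgue_integral_def
      using set_integrable_abs[OF int_gc] unfolding set_integrable_def
      by (intro nn_integral_eq_integral) auto
    finally show ?thesis .
  qed
  have "\<bar>LINT x:Q|leb d. g x - c\<bar> \<le> I"
    unfolding I_def set_lebesgue_integral_def
    using integral_abs_bound[of "leb d" "\<lambda>x. indicat_real Q x *\<^sub>R (g x - c)"]
    by (simp add: abs_mult)
  then have dev: "\<bar>avg d Q g - c\<bar> \<le> I / m" unfolding diff using mpos by (simp add: divide_right_mono)
  have "(\<integral>\<^sup>+x\<in>Q. ennreal \<bar>g x - avg d Q g\<bar> \<partial>leb d)
     \<le> (\<integral>\<^sup>+x. ennreal \<bar>g x - c\<bar> * indicator Q x + ennreal (I / m) * indicator Q x \<partial>leb d)"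
  proof (rule nn_integral_mono)
    fix x
    have "ennreal \<bar>g x - avg d Q g\<bar> \<le> ennreal (\<bar>g x - c\<bar> + I / m)"
      using dev by (intro ennreal_leI) linarith
    also have "\<dots> = ennreal \<bar>g x - c\<bar> + ennreal (I / m)"
      using dev by (intro ennreal_plus) auto
    finally show "ennreal \<bar>g x - avg d Q g\<bar> * indicator Q x
        \<le> ennreal \<bar>g x - c\<bar> * indicator Q x + ennreal (I / m) * indicator Q x"
      by (auto simp: indicator_def)
  qed
  also have "\<dots> = ennreal I + ennreal (I / m) * ennreal m"
    using g by (subst nn_integral_add) (auto simp: I nn_integral_cmult_indicator em)
  also have "\<dots> = 2 * ennreal I"
    using mpos dev by (subst ennreal_mult[symmetric]) (auto simp: mult_2)
  finally have "(\<integral>\<^sup>+x\<in>Q. ennreal \<bar>g x - avg d Q g\<bar> \<partial>leb d) \<le> 2 * (\<integral>\<^sup>+x\<in>Q. ennreal \<bar>g x - c\<bar> \<partial>leb d)"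
    unfolding I .
  then show ?thesis
    unfolding avg1_def by (simp add: ennreal_times_divide divide_right_mono_ennreal)
qed

section \<open>The sparse operator on a fixed cube of the grid\<close>

locale weighted_sparse_setting =
  fixes d :: nat and D :: "(nat \<Rightarrow> real) set set" and w :: "(nat \<Rightarrow> real) \<Rightarrow> real"
    and \<eta> :: real and \<S> :: "(nat \<Rightarrow> real) set set" and f :: "(nat \<Rightarrow> real) \<Rightarrow> real"
    and E :: "(nat \<Rightarrow> real) set \<Rightarrow> (nat \<Rightarrow> real) set"
  assumes grid: "dyadic_grid d D" and weight: "weight d w" and A1: "A1 d (\<lambda>x. inverse (w x))"
    and eta: "0 < \<eta>" and sub: "\<S> \<subseteq> D"
    and disj: "disjoint_family_on E \<S>"
    and core: "\<And>P. P \<in> \<S> \<Longrightarrow> E P \<in> sets (leb d)" "\<And>P. P \<in> \<S> \<Longrightarrow> E P \<subseteq> P"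
      "\<And>P. P \<in> \<S> \<Longrightarrow> ennreal \<eta> * emeasure (leb d) P \<le> emeasure (leb d) (E P)"
    and summable: "(\<Sum>\<^sub>\<infinity>Q\<in>\<S>. emeasure (leb d) Q) < \<infinity>"
    and f: "f \<in> Linf d w"
begin

abbreviation v :: "(nat \<Rightarrow> real) \<Rightarrow> real" where "v \<equiv> \<lambda>x. inverse (w x)"
abbreviation K :: ennreal where "K \<equiv> Linf_norm d w f"

lemma D_cubes: "Q \<in> D \<Longrightarrow> Q \<in> cubes d"
  using grid by (auto simp: dyadic_grid_def)

lemma D_sets [measurable]: "Q \<in> D \<Longrightarrow> Q \<in> sets (leb d)"
  by (rule sets_leb_cube[OF D_cubes])

lemma D_pos: "Q \<in> D \<Longrightarrow> 0 < emeasure (leb d) Q" and D_finite: "Q \<in> D \<Longrightarrow> emeasure (leb d) Q < \<infinity>"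
  using emeasure_leb_cube[OF D_cubes] by auto

lemma D_laminar: "P \<in> D \<Longrightarrow> R \<in> D \<Longrightarrow> P \<inter> R \<noteq> {} \<Longrightarrow> P \<subseteq> R \<or> R \<subseteq> P"
  using grid by (auto simp: dyadic_grid_def)

text \<open>
  Every cube containing \<open>Q\<close> has at least its measure, and the measures are summable.
\<close>

lemma finite_ancestors: "Q \<in> D \<Longrightarrow> finite {R \<in> \<S>. Q \<subseteq> R}"
  using sub D_sets
  by (intro finite_subset[OF _ finite_large_terms_of_infsum_ennreal[OF summable D_pos[of Q]]])
    (auto intro!: emeasure_mono)

sublocale sparse_family "leb d" \<S> E \<eta>
proof
  show "countable \<S>"
    using sub D_pos by (intro countable_of_infsum_ennreal_finite[OF summable]) auto
  fix P R assume PR: "P \<in> \<S>" "R \<in> \<S>" "P \<inter> R \<noteq> {}"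
  then show "P \<subseteq> R \<or> R \<subseteq> P" using sub by (intro D_laminar) auto
qed (use sub D_sets finite_ancestors eta disj core in auto)

lemma w_meas [measurable]: "w \<in> borel_measurable (leb d)"
  and w_pos: "AE x in leb d. 0 < w x"
  using weight by (auto simp: weight_def)

lemma f_meas [measurable]: "f \<in> borel_measurable (leb d)"
  using f by (simp add: Linf_def)

lemma wmeasure_eq: "wmeasure d v Q = (\<integral>\<^sup>+x\<in>Q. ennreal \<bar>v x\<bar> \<partial>leb d)"
  unfolding wmeasure_def using w_pos by (intro nn_integral_cong_AE) (auto elim!: eventually_mono)

lemma avg1_v: "avg1 d Q v = wmeasure d v Q / emeasure (leb d) Q"
  by (simp add: avg1_def wmeasure_eq)

text \<open>As \<open>w > 0\<close> almost everywhere, the definition of \<open>K\<close> gives \<open>\<bar>f\<bar> \<le> K v\<close> almost everywhere.\<close>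

lemma integral_f_le: "Q \<in> D \<Longrightarrow> (\<integral>\<^sup>+x\<in>Q. ennreal \<bar>f x\<bar> \<partial>leb d) \<le> K * wmeasure d v Q"
proof -
  assume [simp]: "Q \<in> D"
  have "AE x in leb d. ennreal \<bar>f x * w x\<bar> \<le> K"
    unfolding Linf_norm_def by (rule esssup_AE)
  then have "AE x in leb d. ennreal \<bar>f x\<bar> * indicator Q x \<le> K * (ennreal (v x) * indicator Q x)"
    using w_pos
  proof eventually_elim
    case (elim x)
    have "ennreal \<bar>f x\<bar> = ennreal \<bar>f x * w x\<bar> * ennreal (v x)"
      using elim(2) by (simp add: ennreal_mult[symmetric] abs_mult)
    also have "\<dots> \<le> K * ennreal (v x)" using elim(1) by (intro mult_right_mono) auto
    finally show ?case by (auto simp: indicator_def)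
  qed
  then have "(\<integral>\<^sup>+x\<in>Q. ennreal \<bar>f x\<bar> \<partial>leb d) \<le> (\<integral>\<^sup>+x. K * (ennreal (v x) * indicator Q x) \<partial>leb d)"
    by (rule nn_integral_mono_AE)
  also have "\<dots> = K * wmeasure d v Q"
    unfolding wmeasure_def by (rule nn_integral_cmult) measurable
  finally show ?thesis .
qed

lemma avg1_f_le: "Q \<in> D \<Longrightarrow> avg1 d Q f \<le> K * avg1 d Q v"
  using divide_right_mono_ennreal[OF integral_f_le[of Q], of "emeasure (leb d) Q"]
  by (simp add: avg1_v avg1_def[of d Q f] ennreal_times_divide)

lemma wmeasure_pos: assumes Q: "Q \<in> D" shows "0 < wmeasure d v Q"
proof (rule ccontr)
  assume "\<not> 0 < wmeasure d v Q"
  then have "(\<integral>\<^sup>+x. ennreal (v x) * indicator Q x \<partial>leb d) = 0" by (simp add: wmeasure_def)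
  then have "AE x in leb d. ennreal (v x) * indicator Q x = 0"
    using Q by (subst (asm) nn_integral_0_iff_AE) auto
  then have "AE x in leb d. x \<notin> Q"
    using w_pos by eventually_elim (auto simp: indicator_def split: if_splits)
  then show False using Q D_pos[OF Q] by (subst (asm) AE_iff_measurable[of Q]) (auto dest: sets.sets_into_space[OF D_sets])
qed

lemma avg_inf_w_pos: assumes Q: "Q \<in> D" shows "0 < avg_inf d Q w"
proof (rule ccontr)
  assume "\<not> 0 < avg_inf d Q w"
  then have "AE x in restrict_space (leb d) Q. ennreal \<bar>w x\<bar> \<le> 0"
    unfolding avg_inf_def using esssup_AE[of "\<lambda>x. ennreal \<bar>w x\<bar>" "restrict_space (leb d) Q"] by simp
  then have "AE x in leb d. x \<in> Q \<longrightarrow> ennreal \<bar>w x\<bar> \<le> 0"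
    using Q by (subst (asm) AE_restrict_space_iff) auto
  then have "AE x in leb d. x \<notin> Q"
    using w_pos by eventually_elim auto
  then show False using Q D_pos[OF Q] by (subst (asm) AE_iff_measurable[of Q]) (auto dest: sets.sets_into_space[OF D_sets])
qed

lemma avg1_mult_avg_inf_le: "Q \<in> D \<Longrightarrow> avg1 d Q v * avg_inf d Q w \<le> A1_const d D v"
  unfolding A1_const_def by (rule SUP_upper2[of Q]) auto

text \<open>
  The \<open>A\<^sub>1\<close> condition bounds a product, and its second factor does not vanish as \<open>w > 0\<close> almost
  everywhere. So averages of \<open>v\<close>, and those of \<open>f\<close>, are finite.
\<close>

lemma avg1_v_finite: assumes Q: "Q \<in> D" shows "avg1 d Q v < \<infinity>"
proof -
  have "avg1 d Q v * avg_inf d Q w \<le> A1_const d (cubes d) v"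
    unfolding A1_const_def using D_cubes[OF Q] by (rule SUP_upper2[of Q]) auto
  also have "\<dots> < \<infinity>" using A1 by (simp add: A1_def)
  finally show ?thesis using avg_inf_w_pos[OF Q]
    by (auto simp: ennreal_mult_less_top less_top top_unique ennreal_top_mult)
qed

lemma avg1_f_finite: "Q \<in> D \<Longrightarrow> avg1 d Q f < \<infinity>"
  using avg1_f_le[of Q] avg1_v_finite[of Q] f
  by (auto simp: Linf_def ennreal_mult_less_top elim: order_le_less_trans)

lemma wmeasure_finite: "Q \<in> D \<Longrightarrow> wmeasure d v Q < \<infinity>"
  using avg1_v_finite[of Q] D_finite[of Q]
  by (auto simp: avg1_v ennreal_divide_eq_top_iff less_top[symmetric])

definition local_part :: "(nat \<Rightarrow> real) set \<Rightarrow> (nat \<Rightarrow> real) \<Rightarrow> ennreal" where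
  "local_part Q x = (\<integral>\<^sup>+P. avg1 d P f * indicator P x \<partial>count_space {P \<in> \<S>. P \<subseteq> Q})"

definition ancestor_sum :: "(nat \<Rightarrow> real) set \<Rightarrow> real" where
  "ancestor_sum Q = enn2real (\<Sum>P\<in>{P \<in> \<S>. Q \<subset> P}. avg1 d P f)"

lemma sparse_op_eq_nn_integral:
  "sparse_op d \<S> f x = (\<integral>\<^sup>+P. avg1 d P f * indicator P x \<partial>count_space \<S>)"
  unfolding sparse_op_def by (rule infsum_ennreal_eq_nn_integral_count_space[OF countable_family])

lemma sparse_op_measurable [measurable]: "sparse_op d \<S> f \<in> borel_measurable (leb d)"
  unfolding sparse_op_eq_nn_integral[abs_def]
  using family_sets by (intro borel_measurable_nn_integral_count_space countable_family) auto

lemma local_part_measurable [measurable]: "local_part Q \<in> borel_measurable (leb d)"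
  unfolding local_part_def[abs_def] using family_sets
  by (intro borel_measurable_nn_integral_count_space countable_subset[OF _ countable_family]) auto

text \<open>
  A cube of the collection that meets \<open>Q\<close> either lies in \<open>Q\<close> or strictly contains it. Cubes of the
  second kind contribute the same finite amount at every point of \<open>Q\<close>.
\<close>

lemma sparse_op_split:
  assumes Q: "Q \<in> D" and x: "x \<in> Q"
  shows "sparse_op d \<S> f x = ennreal (ancestor_sum Q) + local_part Q x"
proof -
  have fin: "finite {P \<in> \<S>. Q \<subset> P}"
    by (rule finite_subset[OF _ finite_ancestors[OF Q]]) auto
  have "(\<Sum>P\<in>{P \<in> \<S>. Q \<subset> P}. avg1 d P f) < \<infinity>"
    using fin avg1_f_finite sub by (auto simp: less_top)
  then have c: "ennreal (ancestor_sum Q) = (\<integral>\<^sup>+P. avg1 d P f \<partial>count_space {P \<in> \<S>. Q \<subset> P})"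
    unfolding ancestor_sum_def by (simp add: nn_integral_count_space_finite[OF fin])
  have "sparse_op d \<S> f x = (\<integral>\<^sup>+P. avg1 d P f * indicator {P. Q \<subset> P} P
      + avg1 d P f * indicator P x * indicator {P. P \<subseteq> Q} P \<partial>count_space \<S>)"
    unfolding sparse_op_eq_nn_integral
  proof (rule nn_integral_cong)
    fix P assume "P \<in> space (count_space \<S>)"
    then have "P \<in> D" using sub by auto
    with D_laminar[OF this Q] x
    show "avg1 d P f * indicator P x
      = avg1 d P f * indicator {P. Q \<subset> P} P + avg1 d P f * indicator P x * indicator {P. P \<subseteq> Q} P"
      by (cases "x \<in> P"; cases "P \<subseteq> Q"; cases "Q \<subset> P") auto
  qed
  also have "\<dots> = ennreal (ancestor_sum Q) + local_part Q x"
    unfolding c local_part_def nn_integral_count_space_Collect by (rule nn_integral_add) auto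
  finally show ?thesis .
qed

text \<open>
  Where the sparse sum is infinite, and its real-valued version is 0, the local part is infinite too.
\<close>

lemma deviation_le_local_part:
  assumes "Q \<in> D" "x \<in> Q"
  shows "ennreal \<bar>sparse_fun d \<S> f x - ancestor_sum Q\<bar> \<le> local_part Q x"
proof (cases "local_part Q x" rule: ennreal_cases)
  case (real r)
  have "0 \<le> ancestor_sum Q" by (simp add: ancestor_sum_def)
  then have "sparse_fun d \<S> f x = ancestor_sum Q + r"
    unfolding sparse_fun_def sparse_op_split[OF assms] real(2) using real(1)
    by (simp add: ennreal_plus[symmetric] del: ennreal_plus)
  then show ?thesis using real by simp
qed simp

lemma weak_L1_norm_le:
  assumes Q: "Q \<in> D"
  shows "weak_L1_norm d Q (\<lambda>x. (sparse_fun d \<S> f x - ancestor_sum Q) * indicator Q x)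
    \<le> ennreal (232 / \<eta>) * (K * wmeasure d v Q)"
  unfolding weak_L1_norm_def
proof (rule SUP_least)
  fix t :: real assume "t \<in> {0<..}"
  then have t: "0 < t" by simp
  have "{x \<in> Q. t < \<bar>(sparse_fun d \<S> f x - ancestor_sum Q) * indicator Q x\<bar>}
      \<subseteq> {x \<in> Q. ennreal t < local_part Q x}"
  proof clarify
    fix x assume "x \<in> Q" "t < \<bar>(sparse_fun d \<S> f x - ancestor_sum Q) * indicator Q x\<bar>"
    then have "ennreal t < ennreal \<bar>sparse_fun d \<S> f x - ancestor_sum Q\<bar>"
      using t by (simp add: ennreal_less_iff)
    also have "\<dots> \<le> local_part Q x" by (rule deviation_le_local_part[OF Q \<open>x \<in> Q\<close>])
    finally show "ennreal t < local_part Q x" .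
  qed
  then have "emeasure (leb d) {x \<in> Q. t < \<bar>(sparse_fun d \<S> f x - ancestor_sum Q) * indicator Q x\<bar>}
      \<le> emeasure (leb d) {x \<in> Q. ennreal t < local_part Q x}"
  proof (rule emeasure_mono)
    have "{x \<in> Q. ennreal t < local_part Q x} = Q \<inter> {x \<in> space (leb d). ennreal t < local_part Q x}"
      using sets.sets_into_space[OF D_sets[OF Q]] by auto
    also have "\<dots> \<in> sets (leb d)"
    proof (rule sets.Int[OF D_sets[OF Q]])
      show "{x \<in> space (leb d). ennreal t < local_part Q x} \<in> sets (leb d)" by measurable
    qed
    finally show "{x \<in> Q. ennreal t < local_part Q x} \<in> sets (leb d)" .
  qed
  then have "ennreal t * emeasure (leb d) {x \<in> Q. t < \<bar>(sparse_fun d \<S> f x - ancestor_sum Q) * indicator Q x\<bar>}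
      \<le> ennreal t * emeasure (leb d) {x \<in> Q. ennreal t < local_part Q x}"
    by (rule mult_left_mono) simp
  also have "\<dots> \<le> ennreal (232 / \<eta>) * (\<integral>\<^sup>+x\<in>Q. ennreal \<bar>f x\<bar> \<partial>leb d)"
    unfolding local_part_def using D_sets[OF Q] t
    by (intro weak_type_sparse_sum) (auto simp: avg1_def ennreal_divide_mult_le)
  also have "\<dots> \<le> ennreal (232 / \<eta>) * (K * wmeasure d v Q)"
    by (intro mult_left_mono integral_f_le Q) simp
  finally show "ennreal t * emeasure (leb d) {x \<in> Q. t < \<bar>(sparse_fun d \<S> f x - ancestor_sum Q) * indicator Q x\<bar>}
      \<le> ennreal (232 / \<eta>) * (K * wmeasure d v Q)" .
qed

lemma integral_maxfun_le:
  assumes Q: "Q \<in> D"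
  shows "(\<integral>\<^sup>+x\<in>Q. maxfun d (subcubes D Q) v x \<partial>leb d) \<le> Ainf_const d D v * wmeasure d v Q"
proof -
  have "(\<integral>\<^sup>+x\<in>Q. maxfun d (subcubes D Q) v x \<partial>leb d)
      = (\<integral>\<^sup>+x\<in>Q. maxfun d (subcubes D Q) v x \<partial>leb d) / wmeasure d v Q * wmeasure d v Q"
    using wmeasure_pos[OF Q] wmeasure_finite[OF Q]
    by (simp add: ennreal_divide_times ennreal_divide_self less_top)
  also have "\<dots> \<le> Ainf_const d D v * wmeasure d v Q"
    unfolding Ainf_const_def using Q by (intro mult_right_mono SUP_upper) auto
  finally show ?thesis .
qed

text \<open>
  For a cube \<open>P \<subseteq> Q\<close> the average of \<open>v\<close> over \<open>P\<close> is a lower bound for the localised maximal function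
  on \<open>P\<close>, in particular on the core of \<open>P\<close>.
\<close>

lemma integral_local_part_le:
  assumes Q: "Q \<in> D"
  shows "ennreal \<eta> * (\<integral>\<^sup>+x\<in>Q. local_part Q x \<partial>leb d) \<le> K * (Ainf_const d D v * wmeasure d v Q)"
proof -
  let ?T = "{P \<in> \<S>. P \<subseteq> Q}"
  have cnt: "countable ?T" by (rule countable_subset[OF _ countable_family]) auto
  have "(\<integral>\<^sup>+x\<in>Q. local_part Q x \<partial>leb d) \<le> (\<integral>\<^sup>+x. local_part Q x \<partial>leb d)"
    by (intro nn_integral_mono) (auto simp: indicator_def)
  also have "\<dots> = (\<integral>\<^sup>+P. \<integral>\<^sup>+x. avg1 d P f * indicator P x \<partial>leb d \<partial>count_space ?T)"
    unfolding local_part_def using family_sets by (intro nn_integral_count_space_nn_integral cnt) auto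
  also have "\<dots> = (\<integral>\<^sup>+P. avg1 d P f * emeasure (leb d) P \<partial>count_space ?T)"
    using family_sets by (intro nn_integral_cong nn_integral_cmult_indicator) auto
  also have "\<dots> \<le> (\<integral>\<^sup>+P. K * (avg1 d P v * emeasure (leb d) P) \<partial>count_space ?T)"
    using avg1_f_le sub
    by (intro nn_integral_mono) (auto simp: mult.assoc[symmetric] intro!: mult_right_mono)
  also have "\<dots> = K * (\<integral>\<^sup>+P. avg1 d P v * emeasure (leb d) P \<partial>count_space ?T)"
    by (rule nn_integral_cmult) simp
  finally have "ennreal \<eta> * (\<integral>\<^sup>+x\<in>Q. local_part Q x \<partial>leb d)
      \<le> ennreal \<eta> * (K * (\<integral>\<^sup>+P. avg1 d P v * emeasure (leb d) P \<partial>count_space ?T))"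
    by (rule mult_left_mono) simp
  also have "\<dots> = K * (ennreal \<eta> * (\<integral>\<^sup>+P. avg1 d P v * emeasure (leb d) P \<partial>count_space ?T))"
    by (simp add: ac_simps)
  also have "\<dots> \<le> K * (\<integral>\<^sup>+x\<in>Q. maxfun d (subcubes D Q) v x \<partial>leb d)"
  proof (intro mult_left_mono sparse_sum_le_integral)
    fix P x assume "P \<in> ?T" "x \<in> P"
    then show "avg1 d P v \<le> maxfun d (subcubes D Q) v x"
      using sub unfolding maxfun_def by (intro SUP_upper2[of P]) (auto simp: subcubes_def)
  qed auto
  also have "\<dots> \<le> K * (Ainf_const d D v * wmeasure d v Q)"
    by (intro mult_left_mono integral_maxfun_le Q) simp
  finally show ?thesis .
qed

lemma mean_oscillation_sparse_fun_le:
  assumes Q: "Q \<in> D"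
  shows "avg1 d Q (\<lambda>x. sparse_fun d \<S> f x - avg d Q (sparse_fun d \<S> f))
    \<le> ennreal (2 / \<eta>) * (Ainf_const d D v * K) * avg1 d Q v"
proof -
  have "(\<integral>\<^sup>+x\<in>Q. ennreal \<bar>sparse_fun d \<S> f x - ancestor_sum Q\<bar> \<partial>leb d)
      \<le> (\<integral>\<^sup>+x\<in>Q. local_part Q x \<partial>leb d)"
    using deviation_le_local_part[OF Q] by (intro nn_integral_mono) (auto simp: indicator_def)
  also have "\<dots> = ennreal (1 / \<eta>) * (ennreal \<eta> * (\<integral>\<^sup>+x\<in>Q. local_part Q x \<partial>leb d))"
    using eta by (simp add: mult.assoc[symmetric] ennreal_mult[symmetric])
  also have "\<dots> \<le> ennreal (1 / \<eta>) * (K * (Ainf_const d D v * wmeasure d v Q))"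
    by (intro mult_left_mono integral_local_part_le Q) simp
  finally have "avg1 d Q (\<lambda>x. sparse_fun d \<S> f x - ancestor_sum Q)
      \<le> ennreal (1 / \<eta>) * (K * (Ainf_const d D v * wmeasure d v Q)) / emeasure (leb d) Q"
    unfolding avg1_def by (rule divide_right_mono_ennreal)
  also have "\<dots> = ennreal (1 / \<eta>) * (Ainf_const d D v * K) * avg1 d Q v"
    by (simp add: avg1_v ennreal_times_divide ac_simps)
  finally have 1: "avg1 d Q (\<lambda>x. sparse_fun d \<S> f x - ancestor_sum Q) \<le> \<dots>" .
  have "avg1 d Q (\<lambda>x. sparse_fun d \<S> f x - avg d Q (sparse_fun d \<S> f))
      \<le> 2 * avg1 d Q (\<lambda>x. sparse_fun d \<S> f x - ancestor_sum Q)"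
    by (rule mean_oscillation_le[OF _ D_cubes[OF Q]]) (simp add: sparse_fun_def[abs_def])
  also have "\<dots> \<le> 2 * (ennreal (1 / \<eta>) * (Ainf_const d D v * K) * avg1 d Q v)"
    by (intro mult_left_mono 1) simp
  also have "\<dots> = ennreal (2 / \<eta>) * (Ainf_const d D v * K) * avg1 d Q v"
    using ennreal_mult[of 2 "1 / \<eta>"] eta by (simp add: mult.assoc)
  finally show ?thesis .
qed

section \<open>The four norm estimates\<close>

lemma BMO1_le: "BMO1 d D w (sparse_fun d \<S> f) \<le> ennreal (2 / \<eta>) * (Ainf_const d D v * K)"
  unfolding BMO1_def
proof (rule SUP_least)
  fix Q assume Q: "Q \<in> D"
  have "0 < avg1 d Q v"
    using wmeasure_pos[OF Q] D_finite[OF Q] by (simp add: avg1_v ennreal_zero_less_divide)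
  then show "avg1 d Q (\<lambda>x. sparse_fun d \<S> f x - avg d Q (sparse_fun d \<S> f)) / avg1 d Q v
      \<le> ennreal (2 / \<eta>) * (Ainf_const d D v * K)"
    using mean_oscillation_sparse_fun_le[OF Q] by (intro divide_le_posI_ennreal) (auto simp: ac_simps)
qed

lemma BMOinf_le:
  "BMOinf d D w (sparse_fun d \<S> f) \<le> ennreal (2 / \<eta>) * (A1_const d D v * Ainf_const d D v * K)"
  unfolding BMOinf_def
proof (rule SUP_least)
  fix Q assume Q: "Q \<in> D"
  have "avg_inf d Q w * avg1 d Q (\<lambda>x. sparse_fun d \<S> f x - avg d Q (sparse_fun d \<S> f))
      \<le> avg_inf d Q w * (ennreal (2 / \<eta>) * (Ainf_const d D v * K) * avg1 d Q v)"
    by (intro mult_left_mono mean_oscillation_sparse_fun_le Q) simp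
  also have "\<dots> = ennreal (2 / \<eta>) * (Ainf_const d D v * K) * (avg1 d Q v * avg_inf d Q w)"
    by (simp add: ac_simps)
  also have "\<dots> \<le> ennreal (2 / \<eta>) * (Ainf_const d D v * K) * A1_const d D v"
    by (intro mult_left_mono avg1_mult_avg_inf_le Q) simp
  finally show "avg_inf d Q w * avg1 d Q (\<lambda>x. sparse_fun d \<S> f x - avg d Q (sparse_fun d \<S> f))
      \<le> ennreal (2 / \<eta>) * (A1_const d D v * Ainf_const d D v * K)"
    by (simp add: ac_simps)
qed

lemma BMO1_weak_le: "BMO1_weak d D w (sparse_fun d \<S> f) \<le> ennreal (232 / \<eta>) * K"
  unfolding BMO1_weak_def
proof (intro SUP_least INF_lower2[OF UNIV_I])
  fix Q assume Q: "Q \<in> D"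
  show "weak_L1_norm d Q (\<lambda>x. (sparse_fun d \<S> f x - ancestor_sum Q) * indicator Q x) / wmeasure d v Q
      \<le> ennreal (232 / \<eta>) * K"
    using weak_L1_norm_le[OF Q] wmeasure_pos[OF Q]
    by (intro divide_le_posI_ennreal) (auto simp: ac_simps)
qed

lemma BMOinf_weak_le:
  "BMOinf_weak d D w (sparse_fun d \<S> f) \<le> ennreal (232 / \<eta>) * (A1_const d D v * K)"
  unfolding BMOinf_weak_def
proof (intro SUP_least INF_lower2[OF UNIV_I])
  fix Q assume Q: "Q \<in> D"
  have "avg_inf d Q w * inverse (emeasure (leb d) Q) *
        weak_L1_norm d Q (\<lambda>x. (sparse_fun d \<S> f x - ancestor_sum Q) * indicator Q x)
      \<le> avg_inf d Q w * inverse (emeasure (leb d) Q) * (ennreal (232 / \<eta>) * (K * wmeasure d v Q))"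
    by (intro mult_left_mono weak_L1_norm_le Q) simp
  also have "\<dots> = ennreal (232 / \<eta>) * K * (avg1 d Q v * avg_inf d Q w)"
    by (simp add: avg1_v divide_ennreal_def ac_simps)
  also have "\<dots> \<le> ennreal (232 / \<eta>) * K * A1_const d D v"
    by (intro mult_left_mono avg1_mult_avg_inf_le Q) simp
  finally show "avg_inf d Q w * inverse (emeasure (leb d) Q) *
        weak_L1_norm d Q (\<lambda>x. (sparse_fun d \<S> f x - ancestor_sum Q) * indicator Q x)
      \<le> ennreal (232 / \<eta>) * (A1_const d D v * K)"
    by (simp add: ac_simps)
qed

end

theorem theorem4p1:
  shows "\<exists>C::real. C > 0 \<and>
    (\<forall>(d::nat) D w (\<eta>::real) \<S>.
      d \<ge> 1 \<longrightarrow> dyadic_grid d D \<longrightarrow>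
      weight d w \<longrightarrow> A1 d (\<lambda>x. inverse (w x)) \<longrightarrow>
      0 < \<eta> \<longrightarrow> \<eta> < 1 \<longrightarrow>
      \<S> \<subseteq> D \<longrightarrow> sparse_collection d \<eta> \<S> \<longrightarrow> (\<Sum>\<^sub>\<infinity>Q\<in>\<S>. emeasure (leb d) Q) < \<infinity> \<longrightarrow>
      (\<forall>f \<in> Linf d w.
         BMO1 d D w (sparse_fun d \<S> f)
           \<le> ennreal C * ennreal (inverse \<eta>) * Ainf_const d D (\<lambda>x. inverse (w x)) * Linf_norm d w f
       \<and> BMOinf d D w (sparse_fun d \<S> f)
           \<le> ennreal C * ennreal (inverse \<eta>) * A1_const d D (\<lambda>x. inverse (w x))
               * Ainf_const d D (\<lambda>x. inverse (w x)) * Linf_norm d w f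
       \<and> BMO1_weak d D w (sparse_fun d \<S> f)
           \<le> ennreal C * ennreal (inverse \<eta>) * Linf_norm d w f
       \<and> BMOinf_weak d D w (sparse_fun d \<S> f)
           \<le> ennreal C * ennreal (inverse \<eta>) * A1_const d D (\<lambda>x. inverse (w x)) * Linf_norm d w f))"
proof (rule exI[of _ 232], intro conjI allI impI ballI)
  fix d D w and \<eta> :: real and \<S> f
  assume grid: "dyadic_grid d D" and weight: "weight d w" and A1: "A1 d (\<lambda>x. inverse (w x))"
    and eta: "0 < \<eta>" and sub: "\<S> \<subseteq> D" and sparse: "sparse_collection d \<eta> \<S>"
    and summable: "(\<Sum>\<^sub>\<infinity>Q\<in>\<S>. emeasure (leb d) Q) < \<infinity>" and f: "f \<in> Linf d w"
  from sparse obtain E where E: "disjoint_family_on E \<S>"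
     "\<forall>S\<in>\<S>. E S \<in> sets (leb d) \<and> E S \<subseteq> S \<and> ennreal \<eta> * emeasure (leb d) S \<le> emeasure (leb d) (E S)"
    unfolding sparse_collection_def by auto
  interpret weighted_sparse_setting d D w \<eta> \<S> f E
    using grid weight A1 eta sub summable f E by unfold_locales auto
  have C: "ennreal (232 / \<eta>) = ennreal 232 * ennreal (inverse \<eta>)"
    using eta by (subst ennreal_mult[symmetric]) (auto simp: divide_inverse)
  have le: "ennreal (2 / \<eta>) * X \<le> ennreal 232 * ennreal (inverse \<eta>) * X" for X
    unfolding C[symmetric] using eta by (intro mult_right_mono ennreal_leI divide_right_mono) auto
  show "BMO1 d D w (sparse_fun d \<S> f)
     \<le> ennreal 232 * ennreal (inverse \<eta>) * Ainf_const d D (\<lambda>x. inverse (w x)) * Linf_norm d w f"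
    using order_trans[OF BMO1_le le] by (simp add: mult.assoc)
  show "BMOinf d D w (sparse_fun d \<S> f)
     \<le> ennreal 232 * ennreal (inverse \<eta>) * A1_const d D (\<lambda>x. inverse (w x))
         * Ainf_const d D (\<lambda>x. inverse (w x)) * Linf_norm d w f"
    using order_trans[OF BMOinf_le le] by (simp add: mult.assoc)
  show "BMO1_weak d D w (sparse_fun d \<S> f) \<le> ennreal 232 * ennreal (inverse \<eta>) * Linf_norm d w f"
    using BMO1_weak_le unfolding C .
  show "BMOinf_weak d D w (sparse_fun d \<S> f)
     \<le> ennreal 232 * ennreal (inverse \<eta>) * A1_const d D (\<lambda>x. inverse (w x)) * Linf_norm d w f"
    using BMOinf_weak_le unfolding C by (simp add: mult.assoc)
qed simp

end
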